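(* Let $\theta_1(b)=-\frac{1}{b^2}\big(\ln(1-b)+b\big)$ for $0<b<1$. The equation $2b\,\theta_1(b)=1$ has a unique solution $b^*$ in $(0,1)$, and with $\kappa=\frac{b^*}{4}$ ($\approx 0.1457$) the following holds: for every $n\ge1$, every nonzero real symmetric $n\times n$ matrix $A$ and every $t>0$, if $\underline{\boldsymbol{x}}\sim N(\underline 0,I_n)$ and $\boldsymbol{\Delta}=\underline{\boldsymbol{x}}^{\mathsf T}A\underline{\boldsymbol{x}}-\mathrm{tr}(A)$, then $$\Pr(\boldsymbol{\Delta}>t)\le\exp\Big(-\kappa\min\Big\{\frac{t^2}{\|A\|_2^2},\frac{t}{\|A\|}\Big\}\Big).$$
   Context: $\|A\|$ is the operator norm of $A$ and $\|A\|_2$ is its Hilbert-Schmidt (Frobenius) norm. The displayed inequality is the Hanson-Wright inequality with constant $\kappa$. *)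

theory Defs
  imports "HOL-Probability.Probability"
begin

definition theta1 :: "real \<Rightarrow> real" where
  "theta1 b = - (1 / b\<^sup>2) * (ln (1 - b) + b)"

(* Meaningful because the equation has exactly one solution in (0,1). *)
definition b_star :: real where
  "b_star = (THE b. 0 < b \<and> b < 1 \<and> 2 * b * theta1 b = 1)"

definition kappa :: real where
  "kappa = b_star / 4"

(* X ~ N(0, I_n) with n = CARD('n): joint density (2 pi)^(-n/2) exp (-|x|^2 / 2),
   written as the product of the one-dimensional standard normal densities. *)
definition std_normal_vector :: "'a measure \<Rightarrow> ('a \<Rightarrow> real ^ 'n) \<Rightarrow> bool" where
  "std_normal_vector M X \<longleftrightarrow>
     distributed M lborel X (\<lambda>x. ennreal (\<Prod>i\<in>UNIV. std_normal_density (x $ i)))"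

definition hs_norm :: "real ^ 'n ^ 'm \<Rightarrow> real" where
  "hs_norm A = sqrt (\<Sum>i\<in>UNIV. \<Sum>j\<in>UNIV. (A $ i $ j)\<^sup>2)"

definition op_norm :: "real ^ 'n ^ 'm \<Rightarrow> real" where
  "op_norm A = onorm (\<lambda>x. A *v x)"

definition Delta :: "real ^ 'n ^ 'n \<Rightarrow> real ^ 'n \<Rightarrow> real" where
  "Delta A x = x \<bullet> (A *v x) - trace A"

end

theory Submission
  imports Defs
begin

text \<open>
  The tail bound is a Chernoff bound with an explicitly known moment generating function. A symmetric
  matrix has an orthonormal eigenbasis (\<open>symmetric_matrix_diagonalizable\<close>), and the standard normal
  distribution is invariant under rotations because Lebesgue measure is
  (\<open>nn_integral_lborel_orthogonal_transformation\<close>). In the eigenbasis the quadratic form is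
  therefore a sum of independent terms \<open>d\<^sub>i * y\<^sub>i\<^sup>2\<close> with standard normal \<open>y\<^sub>i\<close>, whose exponential
  moments are one-dimensional Gaussian integrals (\<open>gaussian_quadratic_form_mgf\<close>).

  After centring, the exponent contributed by \<open>d\<^sub>i\<close> is \<open>(- ln (1 - u) - u) / 2\<close> with
  \<open>u = 2 * l * d\<^sub>i\<close>. It is at most \<open>u\<^sup>2 * theta1 b / 2\<close> as long as \<open>\<bar>u\<bar> \<le> b\<close>
  (\<open>theta1_quadratic_bound\<close>). With \<open>S = (hs_norm A)\<^sup>2\<close> and \<open>N = op_norm A\<close>, every \<open>l > 0\<close> with
  \<open>2 * l * N \<le> b\<close> thus bounds the tail by the exponential of \<open>- l * t + 2 * l\<^sup>2 * theta1 b * S\<close>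
  (\<open>normal_quadratic_form_chernoff\<close>).

  The choice \<open>b = b_star\<close>, for which \<open>2 * theta1 b = 1 / b\<close>, balances the two regimes. If the
  minimiser \<open>l = b * t / (2 * S)\<close> is admissible, that is if \<open>t * N \<le> S\<close>, the exponent is
  \<open>- b * t\<^sup>2 / (4 * S)\<close>. Otherwise \<open>S < t * N\<close>, and \<open>l = b / (2 * N)\<close> gives at most
  \<open>- b * t / (4 * N)\<close>. The constant is \<open>kappa = b / 4\<close> in both.
\<close>

section \<open>The function \<open>theta1\<close> and the constant \<open>b_star\<close>\<close>

text \<open>
  For \<open>0 < \<bar>v\<bar> < 1\<close>, \<^term>\<open>theta1 v\<close> is the sum of the power series \<open>v ^ k / (k + 2)\<close>, whose
  coefficients are positive, so \<open>theta1 u \<le> theta1 \<bar>u\<bar> \<le> theta1 b\<close> term by term. Negative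
  \<open>u\<close> has to be covered because the matrix may have negative eigenvalues.
\<close>

lemma theta1_quadratic_bound:
  fixes u b :: real
  assumes b: "0 < b" "b < 1" and u: "\<bar>u\<bar> \<le> b"
  shows "- ln (1 - u) - u \<le> u\<^sup>2 * theta1 b"
proof -
  have series: "(\<lambda>k. v ^ (k + 2) / real (k + 2)) sums (- ln (1 - v) - v)"
    if "\<bar>v\<bar> < 1" for v :: real
  proof -
    have "(\<lambda>n. v ^ n / real n) sums (- ln (1 - v))"
      using sums_minus[OF ln_series'[of "- v"]] that by simp
    from sums_split_initial_segment[OF this, of 2] show ?thesis
      by (simp add: numeral_2_eq_2)
  qed
  have "- ln (1 - u) - u \<le> (u\<^sup>2 / b\<^sup>2) * (- ln (1 - b) - b)"
  proof (rule sums_le)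
    show "(\<lambda>k. u ^ (k + 2) / real (k + 2)) sums (- ln (1 - u) - u)"
      using series[of u] b u by simp
    show "(\<lambda>k. (u\<^sup>2 / b\<^sup>2) * (b ^ (k + 2) / real (k + 2)))
            sums ((u\<^sup>2 / b\<^sup>2) * (- ln (1 - b) - b))"
      by (rule sums_mult[OF series]) (use b in simp)
    show "u ^ (k + 2) / real (k + 2) \<le> (u\<^sup>2 / b\<^sup>2) * (b ^ (k + 2) / real (k + 2))" for k
    proof -
      have "u ^ k \<le> \<bar>u ^ k\<bar>" by simp
      also have "\<dots> \<le> b ^ k" unfolding power_abs using u by (intro power_mono) auto
      finally have "u\<^sup>2 * u ^ k \<le> u\<^sup>2 * b ^ k" by (intro mult_left_mono) auto
      then have "u ^ (k + 2) / real (k + 2) \<le> (u\<^sup>2 * b ^ k) / real (k + 2)"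
        by (intro divide_right_mono) (simp_all add: power_add power2_eq_square mult_ac)
      also have "\<dots> = (u\<^sup>2 / b\<^sup>2) * (b ^ (k + 2) / real (k + 2))"
        using b by (simp add: power_add power2_eq_square)
      finally show ?thesis .
    qed
  qed
  also have "\<dots> = u\<^sup>2 * theta1 b"
    by (simp add: theta1_def algebra_simps add_divide_distrib diff_divide_distrib)
  finally show ?thesis .
qed

lemma theta1_equation_iff:
  fixes b :: real
  assumes "0 < b"
  shows "2 * b * theta1 b = 1 \<longleftrightarrow> 2 * ln (1 - b) + 3 * b = 0"
proof -
  have "2 * b * theta1 b = - (2 * (ln (1 - b) + b)) / b"
    using assms by (simp add: theta1_def power2_eq_square algebra_simps diff_divide_distrib add_divide_distrib)
  also have "\<dots> = 1 \<longleftrightarrow> - (2 * (ln (1 - b) + b)) = b"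
    using assms by (subst divide_eq_1_iff) auto
  also have "\<dots> \<longleftrightarrow> 2 * ln (1 - b) + 3 * b = 0"
    by argo
  finally show ?thesis .
qed

text \<open>
  These two values locate \<^term>\<open>b_star\<close>: at \<open>b = 0.5826\<close> the function \<open>2 * ln (1 - b) + 3 * b\<close> is
  positive, at \<open>b = 0.583\<close> it is negative. Dividing the endpoints by four gives exactly the
  tolerance \<open>0.00005\<close> around \<open>0.1457\<close>.
\<close>

lemma ln_bounds_at_b_star_endpoints:
  "ln (1 - 0.5826 :: real) > - 0.8739" "ln (1 - 0.583 :: real) < - 0.8745"
proof -
  have 1: "ln (1 - 0.5826 :: real) = - ln (5000 / 2087)"
    using ln_div[of 1 "5000/2087 :: real"] by simp
  have 2: "ln (1 - 0.583 :: real) = - ln (1000 / 417)"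
    using ln_div[of 1 "1000/417 :: real"] by simp
  have "ln (5000 / 2087 :: real) < 0.8739"
    using ln_approx_bounds[of "5000/2087" 4] by (simp add: eval_nat_numeral field_simps)
  then show "ln (1 - 0.5826 :: real) > - 0.8739" unfolding 1 by simp
  have "ln (1000 / 417 :: real) > 0.8745"
    using ln_approx_bounds[of "1000/417" 5] by (simp add: eval_nat_numeral field_simps)
  then show "ln (1 - 0.583 :: real) < - 0.8745" unfolding 2 by simp
qed

text \<open>
  Existence is the intermediate value theorem. For uniqueness, \<open>f b = 2 * ln (1 - b) + 3 * b\<close> has
  the additional zero \<open>0\<close>; a second zero in the open interval would, by Rolle's theorem, give two
  critical points of \<open>f\<close>, but \<open>1 / 3\<close> is the only one.
\<close>

lemma theta1_equation_solution:
  obtains b where "0.5826 < b" "b < 0.583" "2 * b * theta1 b = 1"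
    "\<And>c. 0 < c \<Longrightarrow> c < 1 \<Longrightarrow> 2 * c * theta1 c = 1 \<Longrightarrow> c = b"
proof -
  define f :: "real \<Rightarrow> real" where "f = (\<lambda>b. 2 * ln (1 - b) + 3 * b)"
  have deriv: "(f has_real_derivative (3 - 2 / (1 - x))) (at x)" if "x < 1" for x
    unfolding f_def using that by (auto intro!: derivative_eq_intros)
  then have cont: "continuous_on {x..y} f" if "y < 1" for x y
    using that by (intro continuous_at_imp_continuous_on ballI DERIV_isCont[OF deriv]) auto
  have f0: "f 0 = 0" by (simp add: f_def)
  have no_two_zeros: False if "0 < x" "x < y" "y < 1" "f x = 0" "f y = 0" for x y
  proof -
    have crit: "\<exists>z. p < z \<and> z < q \<and> z = 1/3" if pq: "p < q" "q < 1" "f p = 0" "f q = 0" for p q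
    proof -
      have "\<exists>z>p. z < q \<and> (3 - 2 / (1 - z)) = 0"
      proof -
        obtain z where "p < z" "z < q" "f q - f p = (q - p) * (3 - 2 / (1 - z))"
          using MVT2[of p q f "\<lambda>x. 3 - 2 / (1 - x)"] deriv pq by force
        then show ?thesis using pq by auto
      qed
      then obtain z where "p < z" "z < q" "3 - 2 / (1 - z) = 0" by blast
      then show ?thesis using pq by (auto simp: field_simps intro!: exI[of _ z])
    qed
    from crit[of 0 x] crit[of x y] that f0 show False by force
  qed
  have "f 0.5826 > 0" "f 0.583 < 0"
    using ln_bounds_at_b_star_endpoints by (simp_all add: f_def)
  then obtain b where b: "0.5826 \<le> b" "b \<le> 0.583" "f b = 0"
    using IVT2'[of f "0.583" 0 "0.5826"] cont by force
  with \<open>f 0.5826 > 0\<close> \<open>f 0.583 < 0\<close> have strict: "0.5826 < b" "b < 0.583"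
    by (metis order_less_le)+
  show ?thesis
  proof (rule that[of b])
    show "2 * b * theta1 b = 1"
      using b strict by (subst theta1_equation_iff) (auto simp: f_def)
    show "c = b" if "0 < c" "c < 1" "2 * c * theta1 c = 1" for c
    proof -
      have "f c = 0" using that theta1_equation_iff[of c] by (simp add: f_def)
      then show ?thesis
        using no_two_zeros[of c b] no_two_zeros[of b c] b strict that
        by (cases c b rule: linorder_cases) auto
    qed
  qed (use strict in auto)
qed

lemma b_star_properties:
  "0.5826 < b_star" "b_star < 0.583" "2 * b_star * theta1 b_star = 1"
  "\<exists>!b. 0 < b \<and> b < 1 \<and> 2 * b * theta1 b = 1"
proof -
  obtain b where b: "0.5826 < b" "b < 0.583" "2 * b * theta1 b = 1"
    "\<And>c. 0 < c \<Longrightarrow> c < 1 \<Longrightarrow> 2 * c * theta1 c = 1 \<Longrightarrow> c = b"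
    by (rule theta1_equation_solution) blast
  have "b_star = b"
    unfolding b_star_def using b by (intro the_equality) auto
  with b show "0.5826 < b_star" "b_star < 0.583" "2 * b_star * theta1 b_star = 1" by auto
  show "\<exists>!b. 0 < b \<and> b < 1 \<and> 2 * b * theta1 b = 1"
    using b by (intro ex1I[of _ b]) auto
qed

section \<open>The spectral theorem for symmetric matrices\<close>

text \<open>
  A maximiser \<open>v\<close> of the Rayleigh quotient on the unit sphere of \<open>S\<close> is an eigenvector. With
  \<open>c\<close> the maximum, the form \<open>q x = c * (x \<bullet> x) - x \<bullet> f x\<close> is nonnegative on \<open>S\<close> and vanishes at
  \<open>v\<close>, so its first variation at \<open>v\<close> in the direction \<open>w = c *\<^sub>R v - f v\<close>, which is
  \<open>2 * (w \<bullet> w)\<close>, has to vanish.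
\<close>

lemma self_adjoint_eigenvector:
  fixes f :: "'a::euclidean_space \<Rightarrow> 'a"
  assumes lin: "linear f" and adj: "\<And>x y. x \<bullet> f y = f x \<bullet> y"
    and S: "subspace S" "f ` S \<subseteq> S" "S \<noteq> {0}"
  obtains v c where "v \<in> S" "norm v = 1" "f v = c *\<^sub>R v"
proof -
  interpret f: linear f by (rule lin)
  let ?K = "sphere 0 1 \<inter> S"
  obtain x where x: "x \<in> S" "x \<noteq> 0" using S subspace_0 by blast
  then have "inverse (norm x) *\<^sub>R x \<in> ?K" using S by (simp add: subspace_scale)
  moreover have "compact ?K" using S closed_subspace by (intro compact_Int_closed) auto
  moreover have "continuous_on ?K (\<lambda>x. x \<bullet> f x)"
    by (intro continuous_intros linear_continuous_on) (simp add: lin linear_linear)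
  ultimately obtain v where v: "v \<in> ?K" and max: "\<And>y. y \<in> ?K \<Longrightarrow> y \<bullet> f y \<le> v \<bullet> f v"
    using continuous_attains_sup[of ?K "\<lambda>x. x \<bullet> f x"] by blast
  define c where "c = v \<bullet> f v"
  have vv: "v \<bullet> v = 1" using v by (simp add: norm_eq_1)
  define q where "q = (\<lambda>x. c * (x \<bullet> x) - x \<bullet> f x)"
  have q_nonneg: "0 \<le> q y" if "y \<in> S" for y
  proof (cases "y = 0")
    case False
    have "inverse (norm y) *\<^sub>R y \<in> ?K" using that False S by (simp add: subspace_scale)
    from max[OF this] have "inverse (norm y) * (inverse (norm y) * (y \<bullet> f y)) \<le> c"
      by (simp add: f.scale c_def)
    then show ?thesis using False
      by (simp add: q_def field_simps power2_norm_eq_inner[symmetric] power2_eq_square)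
  qed (simp add: q_def)
  define w where "w = c *\<^sub>R v - f v"
  have w: "w \<in> S" unfolding w_def using v S by (auto intro!: subspace_diff subspace_scale)
  have vfw: "v \<bullet> f w = f v \<bullet> w" and wfv: "w \<bullet> f v = f v \<bullet> w"
    by (rule adj) (rule inner_commute)
  have "w \<bullet> w = (c *\<^sub>R v - f v) \<bullet> w" by (simp add: w_def)
  then have ww: "w \<bullet> w = c * (v \<bullet> w) - f v \<bullet> w" by (simp add: inner_diff_left)
  have expand: "q (v + s *\<^sub>R w) = 2 * s * (w \<bullet> w) + s\<^sup>2 * q w" for s
    unfolding q_def
    by (simp add: f.add f.scale inner_add_left inner_add_right inner_commute[of w v] vfw wfv ww vv
          c_def[symmetric] algebra_simps power2_eq_square)
  have "w \<bullet> w = 0"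
  proof (rule ccontr)
    assume "w \<bullet> w \<noteq> 0"
    then have pos: "0 < w \<bullet> w" by (simp add: less_le)
    have qw: "0 \<le> q w" using q_nonneg[OF w] .
    \<comment> \<open>a step so short and negative that the linear term of the variation dominates the quadratic one\<close>
    define s where "s = - (w \<bullet> w) / (1 + q w)"
    have s: "s < 0" "s * (1 + q w) = - (w \<bullet> w)"
      using pos qw by (simp_all add: s_def divide_simps)
    have "0 \<le> q (v + s *\<^sub>R w)"
      using v w S by (intro q_nonneg) (auto intro!: subspace_add subspace_scale)
    also have "\<dots> = s * (2 * (w \<bullet> w) + s * q w)"
      unfolding expand by (simp add: algebra_simps power2_eq_square)
    also have "\<dots> = s * (w \<bullet> w - s)"
    proof -
      have "s * q w = - (w \<bullet> w) - s" using s(2) by (simp add: algebra_simps)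
      then show ?thesis by simp
    qed
    also have "\<dots> < 0" using s(1) pos by (intro mult_neg_pos) linarith+
    finally show False by simp
  qed
  then have "f v = c *\<^sub>R v" by (simp add: w_def)
  with v that show thesis by auto
qed

text \<open>
  Induction on the dimension: the orthogonal complement in \<open>S\<close> of an eigenvector is again
  invariant, because \<open>f\<close> is self-adjoint.
\<close>

lemma self_adjoint_orthonormal_eigenvectors:
  fixes f :: "'a::euclidean_space \<Rightarrow> 'a"
  assumes lin: "linear f" and adj: "\<And>x y. x \<bullet> f y = f x \<bullet> y"
    and "subspace S" "f ` S \<subseteq> S"
  shows "\<exists>B. pairwise orthogonal B \<and> (\<forall>v\<in>B. norm v = 1 \<and> (\<exists>c. f v = c *\<^sub>R v)) \<and> span B = S"
  using assms(3,4)
proof (induction "dim S" arbitrary: S rule: less_induct)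
  case less
  interpret f: linear f by (rule lin)
  show ?case
  proof (cases "S = {0}")
    case True
    then show ?thesis by (intro exI[of _ "{}"]) auto
  next
    case False
    then obtain v c where v: "v \<in> S" "norm v = 1" "f v = c *\<^sub>R v"
      using self_adjoint_eigenvector[OF lin adj less.prems] by blast
    define T where "T = S \<inter> {x. v \<bullet> x = 0}"
    have subT: "subspace T"
      unfolding T_def using less.prems(1) by (intro subspace_inter subspace_hyperplane)
    have fT: "f ` T \<subseteq> T"
      using less.prems v by (auto simp: T_def adj)
    have "v \<notin> T" using v by (auto simp: T_def norm_eq_1)
    moreover have "T \<subseteq> S" by (simp add: T_def)
    ultimately have "T \<subset> S" using v by blast
    then have "span T \<subset> span S"
      using subT less.prems(1) by (simp add: span_eq_iff[THEN iffD2])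
    then have "dim T < dim S" by (rule dim_psubset)
    from less.hyps[OF this subT fT] obtain B where
      B: "pairwise orthogonal B" "\<And>v. v \<in> B \<Longrightarrow> norm v = 1 \<and> (\<exists>c. f v = c *\<^sub>R v)" "span B = T"
      by blast
    have BT: "B \<subseteq> T" using B(3) span_superset by blast
    have "span (insert v B) = S"
    proof
      show "span (insert v B) \<subseteq> S"
        using BT v less.prems by (intro span_minimal) (auto simp: T_def)
      show "S \<subseteq> span (insert v B)"
      proof
        fix x assume x: "x \<in> S"
        have "x - (v \<bullet> x) *\<^sub>R v \<in> T"
          using x v less.prems
          by (auto simp: T_def inner_simps norm_eq_1 intro!: subspace_diff subspace_scale)
        then show "x \<in> span (insert v B)"
          using B(3) by (auto simp: span_insert)
      qed
    qed
    moreover have "pairwise orthogonal (insert v B)"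
      using B(1) BT by (auto simp: pairwise_insert orthogonal_def T_def inner_commute)
    ultimately show ?thesis using B(2) v by (intro exI[of _ "insert v B"]) auto
  qed
qed

lemma symmetric_matrix_diagonalizable:
  fixes A :: "real ^ 'n ^ 'n"
  assumes sym: "transpose A = A"
  obtains P d where "orthogonal_matrix P" "transpose P ** A ** P = (\<chi> i j. if i = j then d i else 0)"
    "\<And>i. A *v column i P = d i *\<^sub>R column i P"
proof -
  have adj: "x \<bullet> (A *v y) = (A *v x) \<bullet> y" for x y
    by (metis dot_lmul_matrix sym vector_transpose_matrix)
  have "linear ((*v) A)" by simp
  from self_adjoint_orthonormal_eigenvectors[OF this adj subspace_UNIV]
  obtain B where B: "pairwise orthogonal B"
    "\<And>v. v \<in> B \<Longrightarrow> norm v = 1 \<and> (\<exists>c. A *v v = c *\<^sub>R v)" "span B = UNIV"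
    by auto
  have indep: "independent B"
    using B by (intro pairwise_orthogonal_independent) force+
  then have "card B = CARD('n)"
    using B(3) indep_card_eq_dim_span by fastforce
  then obtain g where g: "bij_betw g (UNIV :: 'n set) B"
    by (metis finite_class.finite_UNIV finite_same_card_bij indep finiteI_independent)
  then have gB: "g i \<in> B" for i by (auto simp: bij_betw_def)
  have "\<forall>i. \<exists>c. A *v g i = c *\<^sub>R g i" using B(2) gB by blast
  from choice[OF this] obtain d where d: "\<And>i. A *v g i = d i *\<^sub>R g i" by blast
  define P :: "real ^ 'n ^ 'n" where "P = (\<chi> i j. g j $ i)"
  have col: "column i P = g i" for i by (simp add: P_def column_def)
  have ortho: "g i \<bullet> g j = (if i = j then 1 else 0)" for i j
  proof (cases "i = j")
    case True
    then show ?thesis using B(2)[OF gB[of j]] by (simp add: norm_eq_1)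
  next
    case False
    then have "g i \<noteq> g j" using g by (auto simp: bij_betw_def inj_on_def)
    then show ?thesis using B(1) gB False by (auto simp: pairwise_def orthogonal_def)
  qed
  have P: "orthogonal_matrix P"
    by (simp add: orthogonal_matrix_orthonormal_columns col norm_eq_1 orthogonal_def ortho)
  have "(transpose P ** A ** P) $ i $ j = g i \<bullet> (A *v g j)" for i j
    unfolding matrix_mul_assoc[symmetric]
    by (simp add: P_def matrix_matrix_mult_def transpose_def inner_vec_def matrix_vector_mult_def)
  then have "transpose P ** A ** P = (\<chi> i j. if i = j then d i else 0)"
    by (simp add: vec_eq_iff d ortho)
  from that[OF P this] show thesis by (simp add: d col)
qed

section \<open>Rotation invariance of Lebesgue measure and product integrals\<close>

lemma nn_integral_lborel_reflect:
  fixes f :: "'a::euclidean_space \<Rightarrow> ennreal"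
  assumes [measurable]: "f \<in> borel_measurable borel"
  shows "(\<integral>\<^sup>+x. f (a - x) \<partial>lborel) = (\<integral>\<^sup>+x. f x \<partial>lborel)"
  by (subst (2) lborel_affine[of "-1" a]) (simp_all add: nn_integral_density nn_integral_distr)

lemma nn_integral_lborel_translate:
  fixes f :: "'a::euclidean_space \<Rightarrow> ennreal"
  assumes [measurable]: "f \<in> borel_measurable borel"
  shows "(\<integral>\<^sup>+x. f (a + x) \<partial>lborel) = (\<integral>\<^sup>+x. f x \<partial>lborel)"
  by (subst (2) lborel_affine[of "1" a]) (simp_all add: nn_integral_density nn_integral_distr)

text \<open>
  The argument that proves Haar measure to be unique. For the indicator \<open>g\<close> of the unit ball, the
  product of the integrals of \<open>f \<circ> T\<close> and of \<open>g\<close> is the double integral of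
  \<open>f (T x) * g (T x + y)\<close>. Translating \<open>x\<close> by the preimage of \<open>y\<close> turns this into the double
  integral of \<open>f (T x - y) * g (T x)\<close>, which is the product of the integrals of \<open>f\<close> and of
  \<open>g \<circ> T = g\<close>. The volume of the ball is positive and finite and can be cancelled.
\<close>

lemma nn_integral_lborel_orthogonal_transformation:
  fixes T :: "'a::euclidean_space \<Rightarrow> 'a" and f :: "'a \<Rightarrow> ennreal"
  assumes T: "orthogonal_transformation T" and f[measurable]: "f \<in> borel_measurable borel"
  shows "(\<integral>\<^sup>+x. f (T x) \<partial>lborel) = (\<integral>\<^sup>+x. f x \<partial>lborel)"
proof -
  interpret lin: linear T using T by (rule orthogonal_transformation_linear)
  have [measurable]: "T \<in> borel_measurable borel"
    using linear_continuous_on[of T UNIV] lin.linear_axioms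
    by (intro borel_measurable_continuous_onI) (simp add: linear_linear)
  define g :: "'a \<Rightarrow> ennreal" where "g = indicator (ball 0 1)"
  have [measurable]: "g \<in> borel_measurable borel" unfolding g_def by (intro borel_measurable_indicator) auto
  define V where "V = (\<integral>\<^sup>+x. g x \<partial>(lborel :: 'a measure))"
  have gT: "g (T x) = g x" for x
    using orthogonal_transformation_norm[OF T] by (simp add: g_def indicator_def)
  have V: "V \<noteq> 0" "V \<noteq> \<infinity>"
    unfolding V_def g_def
    using emeasure_lborel_ball_finite[of "0::'a" 1] content_ball_pos[of 1 "0::'a"]
    by (auto simp: measure_def)
  have "(\<integral>\<^sup>+x. f (T x) \<partial>lborel) * V
      = (\<integral>\<^sup>+x. f (T x) * (\<integral>\<^sup>+y. g (T x + y) \<partial>lborel) \<partial>lborel)"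
    by (simp add: nn_integral_lborel_translate V_def nn_integral_multc)
  also have "\<dots> = (\<integral>\<^sup>+x. (\<integral>\<^sup>+y. f (T x) * g (T x + y) \<partial>lborel) \<partial>lborel)"
    by (simp add: nn_integral_cmult)
  also have "\<dots> = (\<integral>\<^sup>+y. (\<integral>\<^sup>+x. f (T x) * g (T x + y) \<partial>lborel) \<partial>lborel)"
    by (rule lborel_pair.Fubini') measurable
  also have "\<dots> = (\<integral>\<^sup>+y. (\<integral>\<^sup>+x. f (T x - y) * g (T x) \<partial>lborel) \<partial>lborel)"
  proof (rule nn_integral_cong)
    fix y
    obtain z where z: "y = T z" using orthogonal_transformation_surj[OF T] by (metis surjD)
    have "(\<integral>\<^sup>+x. f (T x) * g (T x + y) \<partial>lborel)
        = (\<integral>\<^sup>+x. f (T (- z + x)) * g (T (- z + x) + y) \<partial>lborel)"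
      by (rule nn_integral_lborel_translate[symmetric]) measurable
    also have "\<dots> = (\<integral>\<^sup>+x. f (T x - y) * g (T x) \<partial>lborel)"
      by (simp add: z lin.diff)
    finally show "(\<integral>\<^sup>+x. f (T x) * g (T x + y) \<partial>lborel)
        = (\<integral>\<^sup>+x. f (T x - y) * g (T x) \<partial>lborel)" .
  qed
  also have "\<dots> = (\<integral>\<^sup>+x. (\<integral>\<^sup>+y. f (T x - y) * g (T x) \<partial>lborel) \<partial>lborel)"
    by (rule lborel_pair.Fubini') measurable
  also have "\<dots> = (\<integral>\<^sup>+x. f x \<partial>lborel) * V"
    by (simp add: nn_integral_multc nn_integral_lborel_reflect gT V_def nn_integral_cmult)
  finally show ?thesis
    using V by (auto simp: mult.commute[of _ V] ennreal_mult_cancel_left)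
qed

lemma nn_integral_lborel_vec_prod:
  fixes f :: "'n::finite \<Rightarrow> real \<Rightarrow> ennreal"
  assumes [measurable]: "\<And>i. f i \<in> borel_measurable borel"
  shows "(\<integral>\<^sup>+x. (\<Prod>i\<in>UNIV. f i (x $ i)) \<partial>(lborel :: (real ^ 'n) measure))
       = (\<Prod>i\<in>UNIV. \<integral>\<^sup>+y. f i y \<partial>lborel)"
proof -
  have Basis: "(Basis :: (real ^ 'n) set) = (\<lambda>i. axis i 1) ` UNIV"
    by (auto simp: Basis_vec_def)
  have inj: "inj (\<lambda>i::'n. axis i (1::real))" by (auto simp: inj_def axis_eq_axis)
  have prod: "(\<Prod>b\<in>Basis. F b) = (\<Prod>i\<in>UNIV. F (axis i 1))" for F :: "real ^ 'n \<Rightarrow> ennreal"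
    unfolding Basis by (subst prod.reindex[OF inj]) simp
  have "(\<integral>\<^sup>+x. (\<Prod>b\<in>Basis. f (axis_index b) (x \<bullet> b)) \<partial>(lborel :: (real ^ 'n) measure))
      = (\<Prod>b\<in>(Basis :: (real ^ 'n) set). \<integral>\<^sup>+y. f (axis_index b) y \<partial>lborel)"
    by (rule nn_integral_lborel_prod) auto
  then show ?thesis by (simp add: prod inner_axis)
qed

text \<open>
  Up to the factor \<open>s = 1 / sqrt (1 - 2 * a)\<close>, the integrand is the centred normal density with
  standard deviation \<open>s\<close>.
\<close>

lemma std_normal_square_mgf:
  fixes a :: real
  assumes a: "2 * a < 1"
  shows "(\<integral>\<^sup>+x. ennreal (std_normal_density x * exp (a * x\<^sup>2)) \<partial>lborel) = ennreal (1 / sqrt (1 - 2 * a))"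
proof -
  define s where "s = 1 / sqrt (1 - 2 * a)"
  have s: "s > 0" "s\<^sup>2 = 1 / (1 - 2 * a)" using a by (simp_all add: s_def power_divide)
  have *: "std_normal_density x * exp (a * x\<^sup>2) = s * normal_density 0 s x" for x
  proof -
    have "- x\<^sup>2 / 2 + a * x\<^sup>2 = - x\<^sup>2 / (2 * s\<^sup>2)"
      unfolding s(2) using a by (simp add: field_simps)
    moreover have "sqrt (2 * pi * s\<^sup>2) = sqrt (2 * pi) * s"
      using s(1) by (simp add: real_sqrt_mult)
    ultimately show ?thesis
      using s(1) by (simp add: normal_density_def exp_add[symmetric])
  qed
  have "(\<integral>\<^sup>+x. ennreal (normal_density 0 s x) \<partial>lborel) = 1"
    using s by (simp add: nn_integral_eq_integral integrable_normal_density integral_normal_density)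
  then show ?thesis
    unfolding * using s(1) by (simp add: ennreal_mult nn_integral_cmult s_def[symmetric])
qed

section \<open>Gaussian quadratic forms\<close>

text \<open>
  The Gaussian density depends on the norm only, so it does not change under the rotation \<open>P\<close> that
  diagonalises the form; after the rotation the integrand is a product of functions of one
  coordinate each.
\<close>

lemma gaussian_quadratic_form_mgf:
  fixes A :: "real ^ 'n ^ 'n"
  assumes P: "orthogonal_matrix P"
    and diag: "transpose P ** A ** P = (\<chi> i j. if i = j then d i else 0)"
    and l: "\<And>i. 2 * (l * d i) < 1"
  shows "(\<integral>\<^sup>+x. ennreal (\<Prod>i\<in>UNIV. std_normal_density (x $ i)) * ennreal (exp (l * (x \<bullet> (A *v x)))) \<partial>lborel)
       = (\<Prod>i\<in>UNIV. ennreal (1 / sqrt (1 - 2 * (l * d i))))"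
proof -
  define F :: "real ^ 'n \<Rightarrow> ennreal" where
    "F x = ennreal (\<Prod>i\<in>UNIV. std_normal_density (x $ i)) * ennreal (exp (l * (x \<bullet> (A *v x))))" for x
  have T: "orthogonal_transformation ((*v) P)"
    using P by (simp add: orthogonal_transformation_matrix)
  have [measurable]: "F \<in> borel_measurable borel"
    unfolding F_def std_normal_density_def
    by (intro borel_measurable_times_ennreal measurable_compose[OF _ measurable_ennreal]
          borel_measurable_continuous_onI continuous_intros) auto
  have density: "(\<Prod>i\<in>UNIV. std_normal_density (x $ i))
      = (1 / sqrt (2 * pi)) ^ CARD('n) * exp (- (x \<bullet> x) / 2)" for x :: "real ^ 'n"
  proof -
    have "(\<Prod>i\<in>UNIV. exp (- (x $ i)\<^sup>2 / 2)) = exp (\<Sum>i\<in>UNIV. - (x $ i)\<^sup>2 / 2)"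
      by (simp add: exp_sum)
    also have "(\<Sum>i\<in>UNIV. - (x $ i)\<^sup>2 / 2) = - (x \<bullet> x) / 2"
      by (simp add: inner_vec_def power2_eq_square sum_negf sum_divide_distrib)
    finally show ?thesis
      unfolding std_normal_density_def prod.distrib by simp
  qed
  have form: "(P *v x) \<bullet> (A *v (P *v x)) = (\<Sum>i\<in>UNIV. d i * (x $ i)\<^sup>2)" for x
  proof -
    have "(P *v x) \<bullet> (A *v (P *v x)) = x \<bullet> ((transpose P ** A ** P) *v x)"
      by (metis dot_lmul_matrix matrix_vector_mul_assoc vector_transpose_matrix)
    also have "\<dots> = (\<Sum>i\<in>UNIV. d i * (x $ i)\<^sup>2)"
    proof -
      have "(if i = j then d i else 0) * y = (if j = i then d i * y else 0)" for i j and y :: real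
        by simp
      then show ?thesis
        unfolding diag by (simp add: inner_vec_def matrix_vector_mult_def power2_eq_square mult_ac)
    qed
    finally show ?thesis .
  qed
  have "F (P *v x) = (\<Prod>i\<in>UNIV. ennreal (std_normal_density (x $ i) * exp (l * d i * (x $ i)\<^sup>2)))" for x
  proof -
    have "(P *v x) \<bullet> (P *v x) = x \<bullet> x"
      using T by (simp add: orthogonal_transformation_def)
    then have "F (P *v x) = ennreal ((\<Prod>i\<in>UNIV. std_normal_density (x $ i)) * exp (\<Sum>i\<in>UNIV. l * d i * (x $ i)\<^sup>2))"
      unfolding F_def form by (simp add: density ennreal_mult' sum_distrib_left mult_ac)
    then show ?thesis
      by (simp add: exp_sum prod.distrib[symmetric] prod_ennreal)
  qed
  then have "(\<integral>\<^sup>+x. F x \<partial>lborel)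
      = (\<integral>\<^sup>+x. (\<Prod>i\<in>UNIV. ennreal (std_normal_density (x $ i) * exp (l * d i * (x $ i)\<^sup>2))) \<partial>lborel)"
    using nn_integral_lborel_orthogonal_transformation[OF T, of F] by simp
  also have "\<dots> = (\<Prod>i\<in>UNIV. \<integral>\<^sup>+y. ennreal (std_normal_density y * exp (l * d i * y\<^sup>2)) \<partial>lborel)"
    by (rule nn_integral_lborel_vec_prod) measurable
  also have "\<dots> = (\<Prod>i\<in>UNIV. ennreal (1 / sqrt (1 - 2 * (l * d i))))"
    using std_normal_square_mgf l by simp
  finally show ?thesis by (simp add: F_def)
qed

lemma op_norm_bound: "norm (A *v x) \<le> op_norm A * norm x" for A :: "real ^ 'n ^ 'm"
  unfolding op_norm_def by (rule onorm) simp

text \<open>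
  Conjugation by an orthogonal matrix preserves the trace. The second identity applies this to
  \<open>A ** A\<close>, since for a symmetric matrix the squared Frobenius norm is the trace of the square.
\<close>

lemma symmetric_matrix_spectral_sums:
  fixes A :: "real ^ 'n ^ 'n"
  assumes sym: "transpose A = A" and P: "orthogonal_matrix P"
    and diag: "transpose P ** A ** P = (\<chi> i j. if i = j then d i else 0)"
  shows "trace A = (\<Sum>i\<in>UNIV. d i)" "(hs_norm A)\<^sup>2 = (\<Sum>i\<in>UNIV. (d i)\<^sup>2)"
proof -
  have conj: "trace (transpose P ** B ** P) = trace B" for B
    using P trace_mul_sym[of "transpose P ** B" P]
    by (simp add: matrix_mul_assoc orthogonal_matrix_def)
  show "trace A = (\<Sum>i\<in>UNIV. d i)"
    using conj[of A] by (simp add: diag trace_def)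
  have "(hs_norm A)\<^sup>2 = (\<Sum>i\<in>UNIV. \<Sum>j\<in>UNIV. (A $ i $ j)\<^sup>2)"
    unfolding hs_norm_def by (intro real_sqrt_pow2 sum_nonneg) auto
  also have "\<dots> = trace (A ** transpose A)"
    by (simp add: trace_def matrix_matrix_mult_def transpose_def power2_eq_square)
  also have "\<dots> = trace (transpose P ** (A ** A) ** P)"
    by (simp add: conj sym)
  also have "transpose P ** (A ** A) ** P = (transpose P ** A ** P) ** (transpose P ** A ** P)"
  proof -
    have PT: "P ** transpose P = mat 1" using P by (simp add: orthogonal_matrix_def)
    have "(transpose P ** A ** P) ** (transpose P ** A ** P)
        = transpose P ** A ** (P ** transpose P) ** A ** P"
      by (simp add: matrix_mul_assoc)
    also have "\<dots> = transpose P ** (A ** A) ** P"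
      unfolding PT by (simp add: matrix_mul_assoc)
    finally show ?thesis ..
  qed
  also have "trace \<dots> = (\<Sum>i\<in>UNIV. (d i)\<^sup>2)"
    unfolding diag
    by (simp add: trace_def matrix_matrix_mult_def power2_eq_square if_distrib cong: if_cong)
  finally show "(hs_norm A)\<^sup>2 = (\<Sum>i\<in>UNIV. (d i)\<^sup>2)" .
qed

text \<open>
  Markov's inequality for \<open>exp (l * Delta A (X \<omega>))\<close>. An eigenvalue \<open>d\<close> of \<open>A\<close> contributes the factor
  \<open>exp (- l * d) / sqrt (1 - u)\<close> with \<open>u = 2 * l * d\<close>, that is the exponential of
  \<open>(- ln (1 - u) - u) / 2\<close>. The condition on \<open>l\<close> ensures \<open>\<bar>u\<bar> \<le> b\<close>, so this exponent is at most
  \<open>u\<^sup>2 * theta1 b / 2\<close>, and the squares of the eigenvalues sum to the squared Frobenius norm.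
\<close>

lemma normal_quadratic_form_chernoff:
  fixes A :: "real ^ 'n ^ 'n"
  assumes M: "prob_space M" "std_normal_vector M X" and sym: "transpose A = A"
    and l: "0 < l" and b: "0 < b" "b < 1" and lb: "2 * l * op_norm A \<le> b"
  shows "measure M {\<omega> \<in> space M. Delta A (X \<omega>) > t}
    \<le> exp (- l * t + 2 * l\<^sup>2 * theta1 b * (hs_norm A)\<^sup>2)"
proof -
  interpret prob_space M by (rule M)
  obtain P d where P: "orthogonal_matrix P"
      "transpose P ** A ** P = (\<chi> i j. if i = j then d i else 0)"
    and eig: "\<And>i. A *v column i P = d i *\<^sub>R column i P"
    using symmetric_matrix_diagonalizable[OF sym] by blast
  have small: "\<bar>2 * (l * d i)\<bar> \<le> b" for i
  proof -
    have n: "norm (column i P) = 1" using P(1) by (simp add: orthogonal_matrix_orthonormal_columns)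
    have "\<bar>d i\<bar> = norm (A *v column i P)" by (simp add: eig n)
    also have "\<dots> \<le> op_norm A" using op_norm_bound[of A "column i P"] by (simp add: n)
    finally have "2 * l * \<bar>d i\<bar> \<le> 2 * l * op_norm A" using l by (intro mult_left_mono) auto
    with lb have "2 * l * \<bar>d i\<bar> \<le> b" by linarith
    then show ?thesis using l by (simp add: abs_mult)
  qed
  have small1: "2 * (l * d i) < 1" for i
    using abs_le_D1[OF small[of i]] b by linarith
  have X: "distributed M lborel X (\<lambda>x. ennreal (\<Prod>i\<in>UNIV. std_normal_density (x $ i)))"
    using M(2) by (simp add: std_normal_vector_def)
  then have [measurable]: "X \<in> measurable M borel"
    by (auto dest: distributed_measurable)
  have quad: "continuous_on UNIV (\<lambda>x. x \<bullet> (A *v x))" by (intro continuous_intros)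
  then have [measurable]: "(\<lambda>x. x \<bullet> (A *v x)) \<in> borel_measurable borel"
    by (rule borel_measurable_continuous_onI)
  then have [measurable]: "Delta A \<in> borel_measurable borel"
    unfolding Delta_def[abs_def] by measurable
  define c where "c = exp (- l * t - l * trace A)"
  have "emeasure M {\<omega> \<in> space M. Delta A (X \<omega>) > t}
      = (\<integral>\<^sup>+\<omega>. indicator {\<omega> \<in> space M. Delta A (X \<omega>) > t} \<omega> \<partial>M)"
    by (rule nn_integral_indicator[symmetric]) measurable
  also have "\<dots> \<le> (\<integral>\<^sup>+\<omega>. ennreal (exp (l * (Delta A (X \<omega>) - t))) \<partial>M)"
  proof (rule nn_integral_mono)
    fix \<omega>
    show "indicator {\<omega> \<in> space M. Delta A (X \<omega>) > t} \<omega> \<le> ennreal (exp (l * (Delta A (X \<omega>) - t)))"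
      using l by (auto simp: indicator_def)
  qed
  also have "\<dots> = (\<integral>\<^sup>+x. ennreal (\<Prod>i\<in>UNIV. std_normal_density (x $ i))
      * ennreal (exp (l * (Delta A x - t))) \<partial>lborel)"
    by (rule distributed_nn_integral[OF X, symmetric]) measurable
  also have "\<dots> = (\<integral>\<^sup>+x. ennreal c * (ennreal (\<Prod>i\<in>UNIV. std_normal_density (x $ i))
      * ennreal (exp (l * (x \<bullet> (A *v x))))) \<partial>lborel)"
  proof (rule nn_integral_cong)
    fix x
    have "exp (l * (Delta A x - t)) = c * exp (l * (x \<bullet> (A *v x)))"
      by (simp add: c_def Delta_def exp_add[symmetric] algebra_simps)
    then show "ennreal (\<Prod>i\<in>UNIV. std_normal_density (x $ i)) * ennreal (exp (l * (Delta A x - t)))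
        = ennreal c * (ennreal (\<Prod>i\<in>UNIV. std_normal_density (x $ i)) * ennreal (exp (l * (x \<bullet> (A *v x)))))"
      by (simp add: ennreal_mult c_def mult_ac)
  qed
  also have "\<dots> = ennreal c * (\<Prod>i\<in>UNIV. ennreal (1 / sqrt (1 - 2 * (l * d i))))"
    by (subst nn_integral_cmult, measurable)
       (subst gaussian_quadratic_form_mgf[OF P small1], simp)
  also have "\<dots> = ennreal (c * (\<Prod>i\<in>UNIV. 1 / sqrt (1 - 2 * (l * d i))))"
    using small1 by (subst prod_ennreal) (auto simp: ennreal_mult c_def prod_nonneg less_imp_le)
  finally have "measure M {\<omega> \<in> space M. Delta A (X \<omega>) > t}
      \<le> c * (\<Prod>i\<in>UNIV. 1 / sqrt (1 - 2 * (l * d i)))"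
    using small1 by (simp add: emeasure_eq_measure c_def prod_nonneg less_imp_le)
  also have "(\<Prod>i\<in>UNIV. 1 / sqrt (1 - 2 * (l * d i)))
      \<le> (\<Prod>i\<in>UNIV. exp (l * d i + 2 * l\<^sup>2 * theta1 b * (d i)\<^sup>2))"
  proof (intro prod_mono conjI)
    fix i
    show "0 \<le> 1 / sqrt (1 - 2 * (l * d i))" using small1[of i] by simp
    have "1 / sqrt (1 - 2 * (l * d i)) = exp (- ln (1 - 2 * (l * d i)) / 2)"
    proof -
      have "sqrt (1 - 2 * (l * d i)) = exp (ln (1 - 2 * (l * d i)) / 2)"
        using small1[of i] by (simp add: ln_sqrt[symmetric])
      then show ?thesis by (simp add: exp_minus field_simps)
    qed
    also have "\<dots> \<le> exp (l * d i + 2 * l\<^sup>2 * theta1 b * (d i)\<^sup>2)"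
      using theta1_quadratic_bound[OF b small[of i]]
      by (simp add: power_mult_distrib algebra_simps)
    finally show "1 / sqrt (1 - 2 * (l * d i)) \<le> exp (l * d i + 2 * l\<^sup>2 * theta1 b * (d i)\<^sup>2)" .
  qed
  also have "\<dots> = exp (l * trace A + 2 * l\<^sup>2 * theta1 b * (hs_norm A)\<^sup>2)"
    by (simp add: exp_sum[symmetric] sum.distrib sum_distrib_left[symmetric]
          symmetric_matrix_spectral_sums[OF sym P])
  finally show ?thesis by (simp add: c_def exp_add[symmetric] mult_left_mono)
qed

section \<open>The Hanson-Wright inequality\<close>

theorem proposition1:
  "(\<exists>!b::real. 0 < b \<and> b < 1 \<and> 2 * b * theta1 b = 1) \<and>
   \<bar>kappa - 0.1457\<bar> \<le> 0.00005 \<and>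
   (\<forall>(A :: real ^ 'n ^ 'n) (t :: real) (M :: 'a measure) (X :: 'a \<Rightarrow> real ^ 'n).
      A \<noteq> 0 \<longrightarrow> transpose A = A \<longrightarrow> t > 0 \<longrightarrow>
      prob_space M \<longrightarrow> std_normal_vector M X \<longrightarrow>
      measure M {\<omega> \<in> space M. Delta A (X \<omega>) > t}
        \<le> exp (- kappa * min (t\<^sup>2 / (hs_norm A)\<^sup>2) (t / op_norm A)))"
proof (intro conjI allI impI)
  show "\<exists>!b::real. 0 < b \<and> b < 1 \<and> 2 * b * theta1 b = 1"
    by (rule b_star_properties)
  show "\<bar>kappa - 0.1457\<bar> \<le> 0.00005"
    using b_star_properties(1,2) by (simp add: kappa_def abs_if)
next
  fix A :: "real ^ 'n ^ 'n" and t :: real and M :: "'a measure" and X :: "'a \<Rightarrow> real ^ 'n"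
  assume A: "A \<noteq> 0" "transpose A = A" and t: "t > 0" and M: "prob_space M" "std_normal_vector M X"
  define b where "b = b_star"
  have b: "0 < b" "b < 1" and theta: "theta1 b = 1 / (2 * b)"
    using b_star_properties(1-3) by (auto simp: b_def field_simps)
  define S N where "S = (hs_norm A)\<^sup>2" and "N = op_norm A"
  have "N \<noteq> 0"
    using A onorm_eq_0[of "(*v) A"] by (auto simp: N_def op_norm_def matrix_eq)
  then have N: "0 < N"
    using onorm_pos_le[of "(*v) A"] by (simp add: N_def op_norm_def less_le)
  obtain i j where "A $ i $ j \<noteq> 0" using A by (auto simp: vec_eq_iff)
  then have "0 < (\<Sum>j\<in>UNIV. (A $ i $ j)\<^sup>2)"
    by (intro sum_pos2[where i = j, OF finite]) auto
  then have "0 < (\<Sum>i\<in>UNIV. \<Sum>j\<in>UNIV. (A $ i $ j)\<^sup>2)"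
    by - (rule sum_pos2[where i = i, OF finite], auto intro: sum_nonneg)
  then have S: "0 < S" by (simp add: S_def hs_norm_def)
  \<comment> \<open>the equation for \<^term>\<open>b_star\<close> turns the factor \<open>2 * theta1 b\<close> into \<open>1 / b\<close>\<close>
  have chernoff: "measure M {\<omega> \<in> space M. Delta A (X \<omega>) > t} \<le> exp (- l * t + l\<^sup>2 * S / b)"
    if "0 < l" "2 * l * N \<le> b" for l
    using normal_quadratic_form_chernoff[OF M A(2) that(1) b, of t] that(2)
    by (simp add: S_def N_def theta)
  show "measure M {\<omega> \<in> space M. Delta A (X \<omega>) > t}
        \<le> exp (- kappa * min (t\<^sup>2 / (hs_norm A)\<^sup>2) (t / op_norm A))"
  proof (cases "t * N \<le> S")
    case True
    \<comment> \<open>the minimiser of the exponent over all \<open>l\<close>; here it is admissible\<close>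
    define l where "l = b * t / (2 * S)"
    have "2 * l * N = b * ((t * N) / S)" by (simp add: l_def)
    also have "\<dots> \<le> b" using True S b by (intro mult_left_le) auto
    finally have "measure M {\<omega> \<in> space M. Delta A (X \<omega>) > t} \<le> exp (- l * t + l\<^sup>2 * S / b)"
      using b t S by (intro chernoff) (auto simp: l_def)
    also have "- l * t + l\<^sup>2 * S / b = - (b / 4) * (t\<^sup>2 / S)"
      using S b by (simp add: l_def power2_eq_square field_simps)
    also have "exp \<dots> \<le> exp (- (b / 4) * min (t\<^sup>2 / S) (t / N))"
      using b by (intro exp_le_cancel_iff[THEN iffD2] mult_left_mono_neg) auto
    finally show ?thesis by (simp add: kappa_def S_def N_def b_def)
  next
    case False
    \<comment> \<open>the minimiser is too large, so the largest admissible \<open>l\<close> is used\<close>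
    define l where "l = b / (2 * N)"
    have "measure M {\<omega> \<in> space M. Delta A (X \<omega>) > t} \<le> exp (- l * t + l\<^sup>2 * S / b)"
      using b N by (intro chernoff) (auto simp: l_def)
    also have "\<dots> \<le> exp (- l * t + l\<^sup>2 * (t * N) / b)"
      using False b by (auto intro!: divide_right_mono mult_left_mono)
    also have "- l * t + l\<^sup>2 * (t * N) / b = - (b / 4) * (t / N)"
      using N b by (simp add: l_def power2_eq_square field_simps)
    also have "exp \<dots> \<le> exp (- (b / 4) * min (t\<^sup>2 / S) (t / N))"
      using b by (intro exp_le_cancel_iff[THEN iffD2] mult_left_mono_neg) auto
    finally show ?thesis by (simp add: kappa_def S_def N_def b_def)
  qed
qed

end
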